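(* Let $V$ be a countable set. Let $(K_t)_{t\ge1}$ be a sequence of irreducible aperiodic Markov transition operators on $V$ and $(\pi_t)_{t\ge1}$ a sequence of finite measures such that $\{(K_t,\pi_t)\}_{t\ge1}$ is a finite non-decreasing environment; set $\pi_0=\pi_1$. For $t\ge s\ge0$ define the operator $O_{s,t}:\ell^2(\tilde\pi_t)\to\ell^2(\tilde\pi_s)$ by $$O_{s,t}f:=K_{s,t}f-\tilde\pi_s(K_{s,t}f),$$ and let $O_{s,t}^{\rightarrow}:\ell^2(\tilde\pi_s)\to\ell^2(\tilde\pi_t)$ be its dual, and $K_{s,t}^{\rightarrow}:\ell^2(\tilde\pi_s)\to\ell^2(\tilde\pi_t)$ the dual of $K_{s,t}:\ell^2(\tilde\pi_t)\to\ell^2(\tilde\pi_s)$. Let $\mathbf 1$ be the constant function equal to $1$, and for $z\in V$ and $t\ge0$ let $h_t^z=\mu_t^z/\tilde\pi_t$. Then: 1. For all $t\ge1$, the family $(O_{s,t})_{s\le t}$ forms a semigroup, i.e. $O_{s,r}O_{r,t}=O_{s,t}$ for all $0\le s\le r\le t$. 2. For all $t\ge s\ge0$ and all $f\in\ell^2(\tilde\pi_s)$, $\;O_{s,t}^{\rightarrow}f=K_{s,t}^{\rightarrow}f-\tilde\pi_s(f)\,K_{s,t}^{\rightarrow}\mathbf 1$. 3. For all $z\in V$ and $t\ge1$, $\;O_{0,t}^{\rightarrow}(h_0^z)=h_t^z-K_{0,t}^{\rightarrow}\mathbf 1$.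
   Context: A Markov transition operator $K$ on $V$ is a map $K:V\times V\to[0,1]$ with $\sum_y K(x,y)=1$ for all $x$; it acts on functions by $(Kf)(x)=\sum_y K(x,y)f(y)$ and on measures by $(\mu K)(y)=\sum_x\mu(x)K(x,y)$. For $0\le s<t$, $K_{s,t}=K_{s+1}\cdots K_t$, and $K_{t,t}=I$. Finite non-decreasing environment: the $\pi_t$ are positive measures ($\pi_t(x)>0$ for all $x$) with, for all $t\ge1$: $\pi_tK_t=\pi_t$; $\pi_t(V)<+\infty$; $\pi_{t+1}(x)\ge\pi_t(x)$ for all $x\in V$. For a finite measure $\pi$, $\tilde\pi:=\pi/\pi(V)$ and $\tilde\pi(f)=\sum_xf(x)\tilde\pi(x)$. $\mu_t^z=\delta_zK_1\cdots K_t$ is the law at time $t$ of the chain started at $z$ ($\mu_0^z=\delta_z$). The dual of an operator $A:\ell^2(\tilde\pi_t)\to\ell^2(\tilde\pi_s)$ is the operator $A^{\rightarrow}:\ell^2(\tilde\pi_s)\to\ell^2(\tilde\pi_t)$ with $\langle Af,g\rangle_{\tilde\pi_s}=\langle f,A^{\rightarrow}g\rangle_{\tilde\pi_t}$, where $\langle f,g\rangle_{\tilde\pi}=\sum_xf(x)g(x)\tilde\pi(x)$. *)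

theory Defs
  imports "HOL-Analysis.Analysis" "HOL-Library.Countable"
begin

type_synonym 'v kernel = "'v \<Rightarrow> 'v \<Rightarrow> real"

definition markov_kernel :: "'v kernel \<Rightarrow> bool" where
  "markov_kernel K \<longleftrightarrow>
     (\<forall>x y. 0 \<le> K x y \<and> K x y \<le> 1) \<and> (\<forall>x. ((\<lambda>y. K x y) has_sum 1) UNIV)"

definition kernel_id :: "'v kernel" where
  "kernel_id x y = (if x = y then 1 else 0)"

definition kernel_comp :: "'v kernel \<Rightarrow> 'v kernel \<Rightarrow> 'v kernel" where
  "kernel_comp K L x y = (\<Sum>\<^sub>\<infinity>z. K x z * L z y)"

primrec kernel_power :: "'v kernel \<Rightarrow> nat \<Rightarrow> 'v kernel" where
  "kernel_power K 0 = kernel_id"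
| "kernel_power K (Suc n) = kernel_comp (kernel_power K n) K"

definition irreducible_kernel :: "'v kernel \<Rightarrow> bool" where
  "irreducible_kernel K \<longleftrightarrow> (\<forall>x y. \<exists>n. kernel_power K n x y > 0)"

definition aperiodic_kernel :: "'v kernel \<Rightarrow> bool" where
  "aperiodic_kernel K \<longleftrightarrow> (\<forall>x. Gcd {n. n \<ge> 1 \<and> kernel_power K n x x > 0} = 1)"

text \<open>The product of \<open>K (s+1), \<dots>, K t\<close> in this order; it is only meant for \<open>s \<le> t\<close>.\<close>

primrec kernel_prod :: "(nat \<Rightarrow> 'v kernel) \<Rightarrow> nat \<Rightarrow> nat \<Rightarrow> 'v kernel" where
  "kernel_prod K s 0 = kernel_id"
| "kernel_prod K s (Suc t) =
     (if s \<le> t then kernel_comp (kernel_prod K s t) (K (Suc t)) else kernel_id)"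

definition fun_action :: "'v kernel \<Rightarrow> ('v \<Rightarrow> real) \<Rightarrow> 'v \<Rightarrow> real" where
  "fun_action K f x = (\<Sum>\<^sub>\<infinity>y. K x y * f y)"

definition measure_action :: "('v \<Rightarrow> real) \<Rightarrow> 'v kernel \<Rightarrow> 'v \<Rightarrow> real" where
  "measure_action \<mu> K y = (\<Sum>\<^sub>\<infinity>x. \<mu> x * K x y)"

text \<open>Only the indices \<open>t \<ge> 1\<close> of \<open>K\<close> and \<open>\<pi>\<close> are constrained.\<close>

definition finite_nondecreasing_environment ::
    "(nat \<Rightarrow> 'v kernel) \<Rightarrow> (nat \<Rightarrow> 'v \<Rightarrow> real) \<Rightarrow> bool" where
  "finite_nondecreasing_environment K \<pi> \<longleftrightarrow>
     (\<forall>t\<ge>1. markov_kernel (K t)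
        \<and> (\<forall>x. \<pi> t x > 0)
        \<and> measure_action (\<pi> t) (K t) = \<pi> t
        \<and> \<pi> t summable_on UNIV
        \<and> (\<forall>x. \<pi> (t + 1) x \<ge> \<pi> t x))"

definition normalized :: "('v \<Rightarrow> real) \<Rightarrow> 'v \<Rightarrow> real" where
  "normalized \<pi> x = \<pi> x / (\<Sum>\<^sub>\<infinity>y. \<pi> y)"

definition mean :: "('v \<Rightarrow> real) \<Rightarrow> ('v \<Rightarrow> real) \<Rightarrow> real" where
  "mean p f = (\<Sum>\<^sub>\<infinity>x. f x * p x)"

definition l2 :: "('v \<Rightarrow> real) \<Rightarrow> ('v \<Rightarrow> real) set" where
  "l2 p = {f. (\<lambda>x. (f x)\<^sup>2 * p x) summable_on UNIV}"

definition l2_inner :: "('v \<Rightarrow> real) \<Rightarrow> ('v \<Rightarrow> real) \<Rightarrow> ('v \<Rightarrow> real) \<Rightarrow> real" where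
  "l2_inner p f g = (\<Sum>\<^sub>\<infinity>x. f x * g x * p x)"

text \<open>In the next two definitions \<open>A\<close> is an operator from \<open>l2 q\<close> to \<open>l2 p\<close>. When \<open>q\<close> is
  positive everywhere, elements of \<open>l2 q\<close> are determined by their inner products, so the dual
  is unique as a function on \<open>l2 p\<close>.\<close>

definition is_dual :: "('v \<Rightarrow> real) \<Rightarrow> ('v \<Rightarrow> real) \<Rightarrow>
    (('v \<Rightarrow> real) \<Rightarrow> 'v \<Rightarrow> real) \<Rightarrow> (('v \<Rightarrow> real) \<Rightarrow> 'v \<Rightarrow> real) \<Rightarrow> bool" where
  "is_dual q p A B \<longleftrightarrow> B \<in> l2 p \<rightarrow> l2 q \<and>
     (\<forall>f\<in>l2 q. \<forall>g\<in>l2 p. l2_inner p (A f) g = l2_inner q f (B g))"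

definition dual :: "('v \<Rightarrow> real) \<Rightarrow> ('v \<Rightarrow> real) \<Rightarrow>
    (('v \<Rightarrow> real) \<Rightarrow> 'v \<Rightarrow> real) \<Rightarrow> ('v \<Rightarrow> real) \<Rightarrow> 'v \<Rightarrow> real" where
  "dual q p A g = (THE h. h \<in> l2 q \<and> (\<forall>f\<in>l2 q. l2_inner p (A f) g = l2_inner q f h))"

definition K_op :: "(nat \<Rightarrow> 'v kernel) \<Rightarrow> nat \<Rightarrow> nat \<Rightarrow> ('v \<Rightarrow> real) \<Rightarrow> 'v \<Rightarrow> real" where
  "K_op K s t = fun_action (kernel_prod K s t)"

definition O_op :: "(nat \<Rightarrow> 'v kernel) \<Rightarrow> (nat \<Rightarrow> 'v \<Rightarrow> real) \<Rightarrow> nat \<Rightarrow> nat \<Rightarrow>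
    ('v \<Rightarrow> real) \<Rightarrow> 'v \<Rightarrow> real" where
  "O_op K \<pi> s t f = (\<lambda>x. K_op K s t f x - mean (normalized (\<pi> s)) (K_op K s t f))"

definition K_dual :: "(nat \<Rightarrow> 'v kernel) \<Rightarrow> (nat \<Rightarrow> 'v \<Rightarrow> real) \<Rightarrow> nat \<Rightarrow> nat \<Rightarrow>
    ('v \<Rightarrow> real) \<Rightarrow> 'v \<Rightarrow> real" where
  "K_dual K \<pi> s t = dual (normalized (\<pi> t)) (normalized (\<pi> s)) (K_op K s t)"

definition O_dual :: "(nat \<Rightarrow> 'v kernel) \<Rightarrow> (nat \<Rightarrow> 'v \<Rightarrow> real) \<Rightarrow> nat \<Rightarrow> nat \<Rightarrow>
    ('v \<Rightarrow> real) \<Rightarrow> 'v \<Rightarrow> real" where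
  "O_dual K \<pi> s t = dual (normalized (\<pi> t)) (normalized (\<pi> s)) (O_op K \<pi> s t)"

primrec law :: "(nat \<Rightarrow> 'v kernel) \<Rightarrow> 'v \<Rightarrow> nat \<Rightarrow> 'v \<Rightarrow> real" where
  "law K z 0 = (\<lambda>x. if x = z then 1 else 0)"
| "law K z (Suc t) = measure_action (law K z t) (K (Suc t))"

definition law_density :: "(nat \<Rightarrow> 'v kernel) \<Rightarrow> (nat \<Rightarrow> 'v \<Rightarrow> real) \<Rightarrow> 'v \<Rightarrow> nat \<Rightarrow> 'v \<Rightarrow> real"
  where "law_density K \<pi> z t x = law K z t x / normalized (\<pi> t) x"

end

theory Submission
  imports Defs
begin

text \<open>Since the \<open>\<pi> t\<close> increase and each is invariant under its own kernel, \<open>\<pi> s K_{s,t} \<le> \<pi> t\<close>.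
  By Cauchy--Schwarz this domination makes \<open>K_{s,t}\<close> bounded from \<open>l2 (\<pi> t)\<close> to \<open>l2 (\<pi> s)\<close>, and
  makes \<open>g \<mapsto> \<Sum>x. \<pi> s x * K_{s,t} x y * g x / \<pi> t y\<close> (up to normalization) a bounded adjoint, by
  Fubini. The semigroup law holds because centering kills constants and Markov kernels fix them.
  Finally \<open>\<langle>O f, g\<rangle> = \<langle>K f, g\<rangle> - \<langle>K f, 1\<rangle> \<langle>1, g\<rangle>\<close> gives the adjoint of \<open>O\<close>, and the adjoint of
  \<open>K_{0,t}\<close> maps the density of the point mass at \<open>z\<close> to that of the law at time \<open>t\<close>.\<close>

section \<open>Infinite real sums and the exchange of summation order\<close>

lemma summable_on_abs_le:
  fixes f g :: "'a \<Rightarrow> real"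
  assumes "g summable_on A" and "\<And>x. x \<in> A \<Longrightarrow> \<bar>f x\<bar> \<le> g x"
  shows "f summable_on A"
  using Infinite_Sum.abs_summable_on_comparison_test'[of g A f] assms
  by (simp add: summable_on_iff_abs_summable_on_real[of f])

lemma has_sum_diff:
  fixes f g :: "'a \<Rightarrow> real"
  assumes "(f has_sum a) A" "(g has_sum b) A"
  shows "((\<lambda>x. f x - g x) has_sum (a - b)) A"
  using has_sum_add[OF assms(1) has_sum_uminusI[OF assms(2)]] by simp

text \<open>Tonelli: without cancellation, iterated summability controls the joint sum. Joint
  summability is what \<open>infsum_swap_banach\<close> asks for before sums may be
  exchanged.\<close>

lemma nonneg_summable_on_product:
  fixes F :: "'a \<Rightarrow> 'b \<Rightarrow> real"
  assumes nonneg: "\<And>x y. 0 \<le> F x y"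
    and inner: "\<And>x. F x summable_on UNIV"
    and outer: "(\<lambda>x. \<Sum>\<^sub>\<infinity>y. F x y) summable_on UNIV"
  shows "(\<lambda>(x, y). F x y) summable_on UNIV \<times> UNIV"
proof -
  have "(\<lambda>z. norm ((\<lambda>(x, y). F x y) z)) summable_on UNIV \<times> UNIV"
    unfolding Infinite_Sum.abs_summable_on_Sigma_iff
    using nonneg inner outer by (simp add: infsum_nonneg)
  then show ?thesis
    using nonneg by (simp add: case_prod_unfold)
qed

lemma summable_on_product_outer:
  fixes F :: "'a \<Rightarrow> 'b \<Rightarrow> real"
  assumes "(\<lambda>(x, y). F x y) summable_on UNIV \<times> UNIV"
  shows "(\<lambda>x. \<Sum>\<^sub>\<infinity>y. F x y) summable_on UNIV"
  using summable_on_Sigma_banach[OF assms] by simp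

lemma summable_on_product_swap:
  fixes F :: "'a \<Rightarrow> 'b \<Rightarrow> real"
  assumes "(\<lambda>(x, y). F x y) summable_on UNIV \<times> UNIV"
  shows "(\<lambda>(y, x). F x y) summable_on UNIV \<times> UNIV"
  using assms by (subst (asm) summable_on_swap) (simp add: case_prod_unfold)

section \<open>Weighted Cauchy--Schwarz, \<open>l2\<close> spaces and uniqueness of duals\<close>

lemma weighted_cauchy_schwarz:
  fixes w f :: "'a \<Rightarrow> real"
  assumes w: "\<And>x. 0 \<le> w x" and sw: "w summable_on A"
    and sf: "(\<lambda>x. w x * (f x)\<^sup>2) summable_on A"
  shows "(\<Sum>\<^sub>\<infinity>x\<in>A. w x * f x)\<^sup>2 \<le> (\<Sum>\<^sub>\<infinity>x\<in>A. w x) * (\<Sum>\<^sub>\<infinity>x\<in>A. w x * (f x)\<^sup>2)"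
proof -
  define S T U where "S = (\<Sum>\<^sub>\<infinity>x\<in>A. w x)" and "T = (\<Sum>\<^sub>\<infinity>x\<in>A. w x * f x)"
    and "U = (\<Sum>\<^sub>\<infinity>x\<in>A. w x * (f x)\<^sup>2)"
  have swf: "(\<lambda>x. w x * f x) summable_on A"
  proof (rule summable_on_abs_le)
    show "(\<lambda>x. w x + w x * (f x)\<^sup>2) summable_on A"
      by (intro summable_on_add sw sf)
    fix x
    have "\<bar>f x\<bar> \<le> 1 + (f x)\<^sup>2"
      using zero_le_power2[of "\<bar>f x\<bar> - 1"] by (simp add: power2_diff)
    then have "w x * \<bar>f x\<bar> \<le> w x * (1 + (f x)\<^sup>2)"
      using w by (intro mult_left_mono)
    then show "\<bar>w x * f x\<bar> \<le> w x + w x * (f x)\<^sup>2"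
      using w[of x] by (simp add: abs_mult algebra_simps)
  qed
  have hs: "(w has_sum S) A" "((\<lambda>x. w x * f x) has_sum T) A"
    "((\<lambda>x. w x * (f x)\<^sup>2) has_sum U) A"
    using sw swf sf by (auto simp: S_def T_def U_def)
  \<comment> \<open>The terms are \<open>w x * (S * f x - T)^2\<close> expanded, with total
    \<open>S * (S * U - T^2)\<close>. Scaling by \<open>S\<close> instead of centering
    \<open>f\<close> at \<open>T / S\<close> avoids a division.\<close>
  have "((\<lambda>x. S\<^sup>2 * (w x * (f x)\<^sup>2) + ((- 2 * S * T) * (w x * f x) + T\<^sup>2 * w x))
      has_sum (S\<^sup>2 * U + ((- 2 * S * T) * T + T\<^sup>2 * S))) A"
    by (intro has_sum_add has_sum_cmult_right hs)
  moreover have "S\<^sup>2 * (w x * (f x)\<^sup>2) + ((- 2 * S * T) * (w x * f x) + T\<^sup>2 * w x)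
      = w x * (S * f x - T)\<^sup>2" for x
    by (simp add: power2_eq_square algebra_simps)
  ultimately have "((\<lambda>x. w x * (S * f x - T)\<^sup>2)
      has_sum (S\<^sup>2 * U + ((- 2 * S * T) * T + T\<^sup>2 * S))) A"
    by simp
  then have "0 \<le> S\<^sup>2 * U + ((- 2 * S * T) * T + T\<^sup>2 * S)"
    by (rule has_sum_nonneg) (simp add: w)
  then have key: "0 \<le> S * (S * U - T\<^sup>2)"
    by (simp add: power2_eq_square algebra_simps)
  have "0 \<le> S"
    unfolding S_def by (rule infsum_nonneg) (simp add: w)
  \<comment> \<open>The factor \<open>S\<close> in \<open>key\<close> cancels only when positive. If
    it vanishes, so does every weight on \<open>A\<close>, and with them \<open>T\<close>.\<close>
  then consider "S = 0" | "S > 0" by linarith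
  then have "T\<^sup>2 \<le> S * U"
  proof cases
    case 1
    then have "w x = 0" if "x \<in> A" for x
      using nonneg_infsum_le_0D[of w A x] sw w that by (simp add: S_def)
    then have "T = 0"
      unfolding T_def by (intro infsum_0) simp
    with 1 show ?thesis by simp
  next
    case 2
    with key show ?thesis by (simp add: zero_le_mult_iff)
  qed
  then show ?thesis by (simp add: S_def T_def U_def)
qed

text \<open>From \<open>(|f x| - |g x|)^2 \<ge> 0\<close> the product is dominated by the sum of the
  squares.\<close>

lemma l2_mult_summable:
  assumes p: "\<And>x. 0 \<le> p x" and f: "f \<in> l2 p" and g: "g \<in> l2 p"
  shows "(\<lambda>x. f x * g x * p x) summable_on UNIV"
proof (rule summable_on_abs_le)
  show "(\<lambda>x. (f x)\<^sup>2 * p x + (g x)\<^sup>2 * p x) summable_on UNIV"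
    using f g by (intro summable_on_add) (auto simp: l2_def)
  fix x
  have "\<bar>f x * g x\<bar> \<le> (f x)\<^sup>2 + (g x)\<^sup>2"
    using zero_le_power2[of "\<bar>f x\<bar> - \<bar>g x\<bar>"] zero_le_power2[of "\<bar>f x\<bar>"]
      zero_le_power2[of "\<bar>g x\<bar>"]
    unfolding power2_diff abs_mult power2_abs by linarith
  then have "\<bar>f x * g x\<bar> * p x \<le> ((f x)\<^sup>2 + (g x)\<^sup>2) * p x"
    using p by (intro mult_right_mono)
  then show "\<bar>f x * g x * p x\<bar> \<le> (f x)\<^sup>2 * p x + (g x)\<^sup>2 * p x"
    using p[of x] by (simp add: abs_mult algebra_simps)
qed

lemma l2_add:
  assumes p: "\<And>x. 0 \<le> p x" and f: "f \<in> l2 p" and g: "g \<in> l2 p"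
  shows "(\<lambda>x. f x + g x) \<in> l2 p"
proof -
  have "(\<lambda>x. (f x)\<^sup>2 * p x + 2 * (f x * g x * p x) + (g x)\<^sup>2 * p x) summable_on UNIV"
    using f g l2_mult_summable[OF p f g]
    by (intro summable_on_add summable_on_cmult_right) (auto simp: l2_def)
  then show ?thesis
    by (simp add: l2_def power2_eq_square algebra_simps)
qed

lemma l2_cmult:
  assumes "f \<in> l2 p"
  shows "(\<lambda>x. c * f x) \<in> l2 p"
  using summable_on_cmult_right[of "\<lambda>x. (f x)\<^sup>2 * p x" UNIV "c\<^sup>2"] assms
  by (simp add: l2_def power_mult_distrib mult.assoc)

lemma l2_diff_cmult:
  assumes "\<And>x. 0 \<le> r x" "f \<in> l2 r" "g \<in> l2 r"
  shows "(\<lambda>x. f x - c * g x) \<in> l2 r"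
  using l2_add[OF assms(1,2) l2_cmult[OF assms(3), of "- c"]] by simp

lemma l2_abs: "f \<in> l2 p \<Longrightarrow> (\<lambda>x. \<bar>f x\<bar>) \<in> l2 p"
  by (simp add: l2_def)

lemma l2_const: "p summable_on UNIV \<Longrightarrow> (\<lambda>_. c) \<in> l2 p"
  by (simp add: l2_def summable_on_cmult_right)

lemma has_sum_delta_mult: "((\<lambda>x. (if x = a then 1 else 0) * f x) has_sum f a) UNIV"
  for f :: "'a \<Rightarrow> real"
  by (rule has_sum_finite_neutralI[of "{a}"]) auto

lemma l2_delta: "(\<lambda>x. if x = a then 1 else 0) \<in> l2 p"
proof -
  have "(\<lambda>x. (if x = a then 1 else 0) * p x) summable_on UNIV"
    by (rule has_sum_imp_summable[OF has_sum_delta_mult])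
  moreover have "((if x = a then 1 else 0)\<^sup>2 :: real) = (if x = a then 1 else 0)" for x
    by simp
  ultimately show ?thesis by (simp add: l2_def)
qed

lemma l2_inner_diff_cmult_right:
  assumes p: "\<And>x. 0 \<le> p x" and f: "f \<in> l2 p" and g: "g \<in> l2 p" and h: "h \<in> l2 p"
  shows "l2_inner p f (\<lambda>x. g x - c * h x) = l2_inner p f g - c * l2_inner p f h"
proof -
  have "((\<lambda>x. f x * g x * p x - c * (f x * h x * p x)) has_sum
      (l2_inner p f g - c * l2_inner p f h)) UNIV"
    unfolding l2_inner_def
    by (intro has_sum_diff has_sum_cmult_right has_sum_infsum l2_mult_summable assms)
  then have "((\<lambda>x. f x * (g x - c * h x) * p x) has_sum
      (l2_inner p f g - c * l2_inner p f h)) UNIV"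
    by (simp add: algebra_simps)
  then show ?thesis
    unfolding l2_inner_def by (rule infsumI)
qed

lemma l2_inner_commute: "l2_inner p f g = l2_inner p g f"
  by (simp add: l2_inner_def mult.commute)

lemma l2_inner_one: "l2_inner p f (\<lambda>_. 1) = mean p f"
  by (simp add: l2_inner_def mean_def)

lemma l2_inner_delta: "l2_inner p (\<lambda>x. if x = a then 1 else 0) h = h a * p a"
  using infsumI[OF has_sum_delta_mult[of a "\<lambda>x. h x * p x"]]
  by (simp add: l2_inner_def mult.assoc)

text \<open>Testing against the point mass at \<open>a\<close> reads off \<open>h a * q a\<close>,
  and \<open>q a > 0\<close>, so at most one \<open>h\<close> represents the functional. Each dual
  below is computed by exhibiting a candidate.\<close>

lemma dual_eqI:
  assumes q: "\<And>x. 0 < q x" and h: "h \<in> l2 q"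
    and eq: "\<And>f. f \<in> l2 q \<Longrightarrow> l2_inner p (A f) g = l2_inner q f h"
  shows "dual q p A g = h"
  unfolding dual_def
proof (rule the_equality)
  show "h \<in> l2 q \<and> (\<forall>f\<in>l2 q. l2_inner p (A f) g = l2_inner q f h)"
    using h eq by blast
  fix h'
  assume h': "h' \<in> l2 q \<and> (\<forall>f\<in>l2 q. l2_inner p (A f) g = l2_inner q f h')"
  show "h' = h"
  proof
    fix a
    have "l2_inner q (\<lambda>x. if x = a then 1 else 0) h' = l2_inner q (\<lambda>x. if x = a then 1 else 0) h"
      using h' eq l2_delta by metis
    then show "h' a = h a"
      using q[of a] by (simp add: l2_inner_delta)
  qed
qed

section \<open>Markov kernels, their composition and their actions\<close>

lemma markov_kernelD:
  assumes "markov_kernel M"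
  shows "0 \<le> M x y" "M x y \<le> 1" "(M x has_sum 1) UNIV"
  using assms by (auto simp: markov_kernel_def)

lemma markov_kernelI:
  assumes "\<And>x y. 0 \<le> M x y" "\<And>x. (M x has_sum 1) UNIV"
  shows "markov_kernel M"
  unfolding markov_kernel_def
proof (intro conjI allI)
  show "M x y \<le> 1" for x y
    using finite_sum_le_has_sum[OF assms(2)[of x], of "{y}"] assms(1) by simp
qed (use assms in auto)

lemma markov_kernel_id: "markov_kernel kernel_id"
proof (rule markov_kernelI)
  fix x :: 'v
  show "(kernel_id x has_sum 1) UNIV"
    using has_sum_delta_mult[of x "\<lambda>_. 1"] by (simp add: kernel_id_def[abs_def] eq_commute)
qed (simp add: kernel_id_def)

lemma measure_action_kernel_id: "measure_action \<mu> kernel_id = \<mu>"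
proof
  fix y
  show "measure_action \<mu> kernel_id y = \<mu> y"
    using infsumI[OF has_sum_delta_mult[of y \<mu>]]
    by (simp add: measure_action_def kernel_id_def mult.commute)
qed

lemma kernel_comp_id_right: "kernel_comp M kernel_id = M"
proof (intro ext)
  fix x y
  show "kernel_comp M kernel_id x y = M x y"
    \<comment> \<open>The row \<open>M x\<close> is treated as a measure.\<close>
    using fun_cong[OF measure_action_kernel_id[of "M x"], of y]
    by (simp add: measure_action_def kernel_comp_def)
qed

text \<open>Fubini for signed \<open>f\<close>: the assumptions on \<open>|f|\<close> give joint
  summability by Tonelli, which passes to \<open>f\<close> by domination. Associativity and the
  action on measures are instances of this exchange.\<close>

lemma fun_action_kernel_comp:
  assumes A: "\<And>z. 0 \<le> A x z" and B: "\<And>z y. 0 \<le> B z y"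
    and inner: "\<And>z. (\<lambda>y. B z y * \<bar>f y\<bar>) summable_on UNIV"
    and outer: "(\<lambda>z. A x z * fun_action B (\<lambda>y. \<bar>f y\<bar>) z) summable_on UNIV"
  shows "fun_action (kernel_comp A B) f x = fun_action A (fun_action B f) x"
proof -
  have "(\<lambda>(z, y). A x z * (B z y * \<bar>f y\<bar>)) summable_on UNIV \<times> UNIV"
    using outer
    by (intro nonneg_summable_on_product)
      (auto simp: A B fun_action_def infsum_cmult_right' intro!: summable_on_cmult_right inner)
  then have "(\<lambda>(z, y). A x z * (B z y * f y)) summable_on UNIV \<times> UNIV"
    by (rule summable_on_abs_le) (auto simp: A B abs_mult)
  then have "(\<Sum>\<^sub>\<infinity>z. \<Sum>\<^sub>\<infinity>y. A x z * (B z y * f y)) = (\<Sum>\<^sub>\<infinity>y. \<Sum>\<^sub>\<infinity>z. A x z * (B z y * f y))"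
    by (rule infsum_swap_banach)
  moreover have "(\<Sum>\<^sub>\<infinity>z. A x z * (B z y * f y)) = kernel_comp A B x y * f y" for y
    by (simp add: kernel_comp_def infsum_cmult_left' flip: mult.assoc)
  ultimately show ?thesis
    by (simp add: fun_action_def infsum_cmult_right')
qed

lemma markov_bounded_summable:
  assumes "markov_kernel M" and "\<And>y. 0 \<le> f y" "\<And>y. f y \<le> 1"
  shows "(\<lambda>y. M x y * f y) summable_on UNIV"
proof (rule summable_on_abs_le)
  show "M x summable_on UNIV"
    using markov_kernelD(3)[OF assms(1)] has_sum_imp_summable by blast
qed (use assms markov_kernelD[OF assms(1)] in \<open>simp add: mult_left_le\<close>)

lemma markov_bounded_action:
  assumes "markov_kernel M" and "\<And>y. 0 \<le> f y" "\<And>y. f y \<le> 1"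
  shows "0 \<le> fun_action M f x" "fun_action M f x \<le> 1"
proof -
  show "0 \<le> fun_action M f x"
    unfolding fun_action_def
    by (rule infsum_nonneg) (simp add: assms markov_kernelD[OF assms(1)])
  have "fun_action M f x \<le> infsum (M x) UNIV"
    unfolding fun_action_def
  proof (rule infsum_mono[OF markov_bounded_summable[OF assms]])
    show "M x summable_on UNIV"
      using markov_kernelD(3)[OF assms(1)] has_sum_imp_summable by blast
  qed (use assms markov_kernelD[OF assms(1)] in \<open>simp add: mult_left_le\<close>)
  also have "\<dots> = 1"
    by (rule infsumI[OF markov_kernelD(3)[OF assms(1)]])
  finally show "fun_action M f x \<le> 1" .
qed

lemma kernel_comp_assoc:
  assumes A: "markov_kernel A" and B: "markov_kernel B" and C: "markov_kernel C"
  shows "kernel_comp (kernel_comp A B) C = kernel_comp A (kernel_comp B C)"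
proof (intro ext)
  fix x y
  \<comment> \<open>A column of \<open>C\<close> is a function with values in \<open>[0,1]\<close>,
    so boundedness supplies all the summability.\<close>
  have "fun_action (kernel_comp A B) (\<lambda>z. C z y) x = fun_action A (fun_action B (\<lambda>z. C z y)) x"
    using markov_kernelD[OF A] markov_kernelD[OF B] markov_kernelD[OF C]
    by (intro fun_action_kernel_comp)
      (auto intro!: markov_bounded_summable markov_bounded_action A B)
  then show "kernel_comp (kernel_comp A B) C x y = kernel_comp A (kernel_comp B C) x y"
    by (simp add: fun_action_def kernel_comp_def)
qed

lemma markov_kernel_comp:
  assumes A: "markov_kernel A" and B: "markov_kernel B"
  shows "markov_kernel (kernel_comp A B)"
proof (rule markov_kernelI)
  note nn = markov_kernelD(1)[OF A] markov_kernelD(1)[OF B]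
  show "0 \<le> kernel_comp A B x y" for x y
    unfolding kernel_comp_def by (rule infsum_nonneg) (simp add: nn)
  fix x
  have B1: "(\<lambda>y. A x z * B z y) summable_on UNIV" "(\<Sum>\<^sub>\<infinity>y. A x z * B z y) = A x z" for z
    using has_sum_cmult_right[OF markov_kernelD(3)[OF B], of "A x z" z]
    by (auto intro: has_sum_imp_summable infsumI)
  have A1: "A x summable_on UNIV" "infsum (A x) UNIV = 1"
    using markov_kernelD(3)[OF A, of x] by (auto intro: has_sum_imp_summable infsumI)
  \<comment> \<open>Summed over \<open>y\<close> first, the array totals 1; joint summability
    transfers this total to the other order, which is the row sum of the composition.\<close>
  have S: "(\<lambda>(z, y). A x z * B z y) summable_on UNIV \<times> UNIV"
    by (rule nonneg_summable_on_product) (simp_all add: nn B1 A1)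
  have "(\<lambda>y. kernel_comp A B x y) summable_on UNIV"
    unfolding kernel_comp_def
    by (rule summable_on_product_outer[OF summable_on_product_swap[OF S]])
  moreover have "(\<Sum>\<^sub>\<infinity>y. kernel_comp A B x y) = 1"
    unfolding kernel_comp_def using infsum_swap_banach[OF S] by (simp add: B1 A1)
  ultimately show "(kernel_comp A B x has_sum 1) UNIV"
    by (metis has_sum_infsum)
qed

lemma measure_action_kernel_comp:
  assumes mu: "\<And>x. 0 \<le> \<mu> x" "\<mu> summable_on UNIV"
    and A: "markov_kernel A" and B: "markov_kernel B"
  shows "measure_action \<mu> (kernel_comp A B) = measure_action (measure_action \<mu> A) B"
proof
  fix y
  let ?f = "\<lambda>z. B z y"
  have f: "0 \<le> ?f z" "?f z \<le> 1" for z
    using markov_kernelD[OF B] by auto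
  \<comment> \<open>The measure is encoded as a kernel with all rows equal to \<open>\<mu>\<close>,
    so the row index \<open>undefined\<close> is arbitrary.\<close>
  have "fun_action (kernel_comp (\<lambda>_. \<mu>) A) ?f undefined = fun_action (\<lambda>_. \<mu>) (fun_action A ?f) undefined"
  proof (rule fun_action_kernel_comp)
    show "(\<lambda>z. \<mu> z * fun_action A (\<lambda>z. \<bar>?f z\<bar>) z) summable_on UNIV"
      using markov_bounded_action[OF A, of ?f] f mu
      by (intro summable_on_abs_le[OF mu(2)]) (simp add: mult_left_le)
  qed (use f mu markov_kernelD[OF A] in \<open>auto intro!: markov_bounded_summable[OF A]\<close>)
  then show "measure_action \<mu> (kernel_comp A B) y = measure_action (measure_action \<mu> A) B y"
    by (simp add: measure_action_def fun_action_def kernel_comp_def)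
qed

section \<open>Dominated kernels: boundedness between \<open>l2\<close> spaces and the
  adjoint\<close>

text \<open>Isolates what the operator theory uses of \<open>K_{s,t}\<close>: here \<open>M\<close>
  stands for \<open>K_{s,t}\<close>, and \<open>p\<close>, \<open>q\<close> for the normalized
  measures at times \<open>s\<close> and \<open>t\<close>. The bound \<open>p M \<le> C q\<close> is
  the trace left by monotonicity of the environment.\<close>

locale dominated_kernel =
  fixes M :: "'v kernel" and p q :: "'v \<Rightarrow> real" and C :: real
  assumes markov: "markov_kernel M"
    and p_pos: "0 < p x" and q_pos: "0 < q x"
    and p_sum: "(p has_sum 1) UNIV"
    and dominated: "measure_action p M y \<le> C * q y"
begin

text \<open>The density with respect to \<open>q\<close> of the signed measure with weights
  \<open>g x * p x\<close> pushed through \<open>M\<close>; the candidate for the dual of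
  \<open>fun_action M\<close>.\<close>

definition adj :: "('v \<Rightarrow> real) \<Rightarrow> 'v \<Rightarrow> real" where
  "adj g y = (\<Sum>\<^sub>\<infinity>x. p x * M x y * g x) / q y"

lemma nonneg: "0 \<le> M x y" "0 \<le> p x" "0 \<le> q x"
  using markov_kernelD(1)[OF markov] p_pos q_pos by (auto simp: less_imp_le)

lemma p_summable: "p summable_on UNIV"
  using p_sum has_sum_imp_summable by blast

lemma column_summable: "(\<lambda>x. p x * M x y) summable_on UNIV"
  by (rule summable_on_abs_le[OF p_summable])
    (use nonneg markov_kernelD(2)[OF markov] in \<open>simp add: mult_left_le\<close>)

text \<open>Summing over \<open>y\<close> first uses only that rows of \<open>M\<close> have mass 1,
  and leaves the \<open>l2 p\<close> sum of \<open>g\<close>.\<close>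

lemma joint_summable_source:
  assumes "g \<in> l2 p"
  shows "(\<lambda>(x, y). p x * M x y * (g x)\<^sup>2) summable_on UNIV \<times> UNIV"
proof (rule nonneg_summable_on_product)
  have hs: "((\<lambda>y. p x * M x y * (g x)\<^sup>2) has_sum (g x)\<^sup>2 * p x) UNIV" for x
    using has_sum_cmult_right[OF markov_kernelD(3)[OF markov], of "(g x)\<^sup>2 * p x" x]
    by (simp add: ac_simps)
  then show "(\<lambda>y. p x * M x y * (g x)\<^sup>2) summable_on UNIV" for x
    using has_sum_imp_summable by blast
  show "(\<lambda>x. \<Sum>\<^sub>\<infinity>y. p x * M x y * (g x)\<^sup>2) summable_on UNIV"
    using assms by (simp add: infsumI[OF hs] l2_def)
qed (simp add: nonneg)

text \<open>Summing over \<open>x\<close> first produces \<open>p M\<close>, which domination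
  replaces by \<open>C q\<close>, leaving a multiple of the \<open>l2 q\<close> sum of
  \<open>f\<close>.\<close>

lemma joint_summable_target:
  assumes "f \<in> l2 q"
  shows "(\<lambda>(x, y). p x * M x y * (f y)\<^sup>2) summable_on UNIV \<times> UNIV"
proof (rule summable_on_product_swap, rule nonneg_summable_on_product)
  show "(\<lambda>x. p x * M x y * (f y)\<^sup>2) summable_on UNIV" for y
    by (intro summable_on_cmult_left column_summable)
  have "(\<lambda>y. C * ((f y)\<^sup>2 * q y)) summable_on UNIV"
    using assms by (intro summable_on_cmult_right) (simp add: l2_def)
  then show "(\<lambda>y. \<Sum>\<^sub>\<infinity>x. p x * M x y * (f y)\<^sup>2) summable_on UNIV"
  proof (rule summable_on_comparison_test)
    fix y
    have "(\<Sum>\<^sub>\<infinity>x. p x * M x y * (f y)\<^sup>2) = measure_action p M y * (f y)\<^sup>2"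
      by (simp add: measure_action_def infsum_cmult_left')
    also have "\<dots> \<le> C * q y * (f y)\<^sup>2"
      by (intro mult_right_mono dominated) simp
    finally show "(\<Sum>\<^sub>\<infinity>x. p x * M x y * (f y)\<^sup>2) \<le> C * ((f y)\<^sup>2 * q y)"
      by (simp add: ac_simps)
  qed (auto intro!: infsum_nonneg simp: nonneg)
qed (simp add: nonneg)

lemma joint_summable:
  assumes f: "f \<in> l2 q" and g: "g \<in> l2 p"
  shows "(\<lambda>(x, y). p x * M x y * (f y * g x)) summable_on UNIV \<times> UNIV"
proof (rule summable_on_abs_le)
  show "(\<lambda>z. (case z of (x, y) \<Rightarrow> p x * M x y * (g x)\<^sup>2)
      + (case z of (x, y) \<Rightarrow> p x * M x y * (f y)\<^sup>2)) summable_on UNIV \<times> UNIV"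
    by (intro summable_on_add joint_summable_source joint_summable_target f g)
  fix z :: "'v \<times> 'v"
  obtain x y where z: "z = (x, y)" by force
  have "\<bar>f y * g x\<bar> \<le> (g x)\<^sup>2 + (f y)\<^sup>2"
    using zero_le_power2[of "\<bar>f y\<bar> - \<bar>g x\<bar>"] zero_le_power2[of "\<bar>f y\<bar>"]
      zero_le_power2[of "\<bar>g x\<bar>"]
    unfolding power2_diff abs_mult power2_abs by linarith
  then have "p x * M x y * \<bar>f y * g x\<bar> \<le> p x * M x y * ((g x)\<^sup>2 + (f y)\<^sup>2)"
    by (intro mult_left_mono) (simp_all add: nonneg)
  then show "\<bar>case z of (x, y) \<Rightarrow> p x * M x y * (f y * g x)\<bar>
      \<le> (case z of (x, y) \<Rightarrow> p x * M x y * (g x)\<^sup>2)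
        + (case z of (x, y) \<Rightarrow> p x * M x y * (f y)\<^sup>2)"
    by (simp add: z abs_mult nonneg distrib_left)
qed

text \<open>A single row of the joint sum with \<open>g = 1\<close>, divided by
  \<open>p x > 0\<close>. Thus \<open>fun_action M f\<close> is a genuine convergent sum at every
  point, not the default value 0.\<close>

lemma row_summable:
  assumes "f \<in> l2 q"
  shows "(\<lambda>y. M x y * f y) summable_on UNIV"
proof -
  have "(\<lambda>y. p x * M x y * (f y * 1)) summable_on UNIV"
    using summable_on_SigmaD1[OF joint_summable[OF assms l2_const[OF p_summable]], of x 1] by simp
  then show ?thesis
    using summable_on_cmult_right'[of "p x" "\<lambda>y. M x y * f y" UNIV] p_pos[of x]
    by (simp add: mult.assoc)
qed

lemma row_square_summable:
  assumes "f \<in> l2 q"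
  shows "(\<lambda>y. M x y * (f y)\<^sup>2) summable_on UNIV"
proof -
  have "(\<lambda>y. p x * M x y * (f y)\<^sup>2) summable_on UNIV"
    using summable_on_SigmaD1[OF joint_summable_target[OF assms], of x] by simp
  then show ?thesis
    using summable_on_cmult_right'[of "p x" "\<lambda>y. M x y * (f y)\<^sup>2" UNIV] p_pos[of x]
    by (simp add: mult.assoc)
qed

text \<open>Jensen's inequality for the square: Cauchy--Schwarz with the probability weights
  \<open>M x\<close>, followed by summation against \<open>p\<close>.\<close>

lemma fun_action_l2:
  assumes f: "f \<in> l2 q"
  shows "fun_action M f \<in> l2 p"
proof -
  have "(\<lambda>x. (fun_action M f x)\<^sup>2 * p x) summable_on UNIV"
  proof (rule summable_on_comparison_test)
    show "(\<lambda>x. \<Sum>\<^sub>\<infinity>y. p x * M x y * (f y)\<^sup>2) summable_on UNIV"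
      by (rule summable_on_product_outer[OF joint_summable_target[OF f]])
    fix x
    have "(fun_action M f x)\<^sup>2 \<le> infsum (M x) UNIV * (\<Sum>\<^sub>\<infinity>y. M x y * (f y)\<^sup>2)"
      unfolding fun_action_def
      by (rule weighted_cauchy_schwarz)
        (auto simp: nonneg row_square_summable[OF f]
          intro: has_sum_imp_summable[OF markov_kernelD(3)[OF markov]])
    then have "(fun_action M f x)\<^sup>2 * p x \<le> (\<Sum>\<^sub>\<infinity>y. M x y * (f y)\<^sup>2) * p x"
      by (intro mult_right_mono) (simp_all add: nonneg infsumI[OF markov_kernelD(3)[OF markov]])
    then show "(fun_action M f x)\<^sup>2 * p x \<le> (\<Sum>\<^sub>\<infinity>y. p x * M x y * (f y)\<^sup>2)"
      by (simp add: mult.assoc infsum_cmult_right' mult.commute)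
  qed (simp add: nonneg)
  then show ?thesis by (simp add: l2_def)
qed

lemma adj_l2:
  assumes g: "g \<in> l2 p"
  shows "adj g \<in> l2 q"
proof -
  have "(\<lambda>y. (adj g y)\<^sup>2 * q y) summable_on UNIV"
  proof (rule summable_on_comparison_test)
    note swapped = summable_on_product_swap[OF joint_summable_source[OF g]]
    show "(\<lambda>y. C * (\<Sum>\<^sub>\<infinity>x. p x * M x y * (g x)\<^sup>2)) summable_on UNIV"
      by (intro summable_on_cmult_right summable_on_product_outer swapped)
    fix y
    let ?S = "\<Sum>\<^sub>\<infinity>x. p x * M x y * (g x)\<^sup>2"
    \<comment> \<open>Cauchy--Schwarz with weights \<open>p x * M x y\<close>. Their mass is at most
      \<open>C * q y\<close>, and this \<open>q y\<close> together with the weight of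
      \<open>l2 q\<close> cancels the squared denominator of \<open>adj\<close>.\<close>
    have "(\<Sum>\<^sub>\<infinity>x. p x * M x y * g x)\<^sup>2 \<le> measure_action p M y * ?S"
      unfolding measure_action_def
      using summable_on_SigmaD1[OF swapped, of y]
      by (intro weighted_cauchy_schwarz) (simp_all add: nonneg column_summable)
    also have "\<dots> \<le> C * q y * ?S"
      by (intro mult_right_mono dominated infsum_nonneg) (simp add: nonneg)
    finally show "(adj g y)\<^sup>2 * q y \<le> C * ?S"
      using q_pos[of y] by (simp add: adj_def power2_eq_square field_simps)
  qed (simp add: nonneg)
  then show ?thesis by (simp add: l2_def)
qed

lemma adj_inner:
  assumes f: "f \<in> l2 q" and g: "g \<in> l2 p"
  shows "l2_inner p (fun_action M f) g = l2_inner q f (adj g)"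
proof -
  have "l2_inner p (fun_action M f) g = (\<Sum>\<^sub>\<infinity>x. \<Sum>\<^sub>\<infinity>y. p x * M x y * (f y * g x))"
    unfolding l2_inner_def fun_action_def
    by (intro infsum_cong)
      (simp add: ac_simps flip: infsum_cmult_left' infsum_cmult_right')
  also have "\<dots> = (\<Sum>\<^sub>\<infinity>y. \<Sum>\<^sub>\<infinity>x. p x * M x y * (f y * g x))"
    by (rule infsum_swap_banach[OF joint_summable[OF f g]])
  also have "\<dots> = l2_inner q f (adj g)"
    unfolding l2_inner_def
  proof (rule infsum_cong)
    fix y
    have "(\<Sum>\<^sub>\<infinity>x. p x * M x y * (f y * g x)) = f y * (\<Sum>\<^sub>\<infinity>x. p x * M x y * g x)"
      by (simp add: ac_simps flip: infsum_cmult_right')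
    then show "(\<Sum>\<^sub>\<infinity>x. p x * M x y * (f y * g x)) = f y * adj g y * q y"
      using q_pos[of y] by (simp add: adj_def)
  qed
  finally show ?thesis .
qed

lemma dual_fun_action: "g \<in> l2 p \<Longrightarrow> dual q p (fun_action M) g = adj g"
  by (rule dual_eqI[OF q_pos adj_l2 adj_inner])

lemma is_dual_fun_action: "is_dual q p (fun_action M) (dual q p (fun_action M))"
  by (simp add: is_dual_def dual_fun_action adj_l2 adj_inner)

section \<open>The centered operator and its adjoint\<close>

definition centered :: "('v \<Rightarrow> real) \<Rightarrow> 'v \<Rightarrow> real" where
  "centered f = (\<lambda>x. fun_action M f x - mean p (fun_action M f))"

text \<open>The subtracted part of \<open>centered\<close> is the rank-one map sending
  \<open>f\<close> to the constant \<open>mean p (fun_action M f)\<close>; its adjoint sends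
  \<open>g\<close> to \<open>mean p g\<close> times \<open>adj\<close> of the constant 1.\<close>

definition centered_adj :: "('v \<Rightarrow> real) \<Rightarrow> 'v \<Rightarrow> real" where
  "centered_adj g = (\<lambda>x. adj g x - mean p g * adj (\<lambda>_. 1) x)"

lemma centered_l2:
  assumes "f \<in> l2 q"
  shows "centered f \<in> l2 p"
  using l2_diff_cmult[OF nonneg(2) fun_action_l2[OF assms] l2_const[OF p_summable, of 1],
      of "mean p (fun_action M f)"]
  by (simp add: centered_def)

lemma centered_adj_l2:
  assumes "g \<in> l2 p"
  shows "centered_adj g \<in> l2 q"
  unfolding centered_adj_def
  by (intro l2_diff_cmult nonneg adj_l2 assms l2_const p_summable)

lemma centered_adj_inner:
  assumes f: "f \<in> l2 q" and g: "g \<in> l2 p"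
  shows "l2_inner p (centered f) g = l2_inner q f (centered_adj g)"
proof -
  note one = l2_const[OF p_summable, of 1]
  \<comment> \<open>The arguments are swapped and a factor 1 inserted to match linearity in the
    right argument. The mean of \<open>fun_action M f\<close> is its inner product with 1, which the
    adjoint then moves onto \<open>f\<close>.\<close>
  have "l2_inner p (centered f) g
      = l2_inner p g (\<lambda>x. fun_action M f x - mean p (fun_action M f) * 1)"
    unfolding centered_def by (subst l2_inner_commute) simp
  also have "\<dots> = l2_inner p g (fun_action M f) - mean p (fun_action M f) * mean p g"
    unfolding l2_inner_diff_cmult_right[OF nonneg(2) g fun_action_l2[OF f] one] l2_inner_one ..
  also have "\<dots> = l2_inner q f (adj g) - mean p g * l2_inner q f (adj (\<lambda>_. 1))"
    using adj_inner[OF f g] adj_inner[OF f one] by (simp add: l2_inner_commute[of p g] l2_inner_one)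
  also have "\<dots> = l2_inner q f (centered_adj g)"
    unfolding centered_adj_def
    by (intro l2_inner_diff_cmult_right[symmetric] nonneg f adj_l2 g one)
  finally show ?thesis .
qed

lemma dual_centered: "g \<in> l2 p \<Longrightarrow> dual q p centered g = centered_adj g"
  by (rule dual_eqI[OF q_pos centered_adj_l2 centered_adj_inner])

lemma is_dual_centered: "is_dual q p centered (dual q p centered)"
  by (simp add: is_dual_def dual_centered centered_adj_l2 centered_adj_inner)

lemma mean_diff_const:
  assumes "f \<in> l2 p"
  shows "mean p (\<lambda>x. f x - c) = mean p f - c"
proof -
  have "(\<lambda>x. f x * p x) summable_on UNIV"
    using l2_mult_summable[OF nonneg(2) assms l2_const[OF p_summable, of 1]] by simp
  then have "((\<lambda>x. f x * p x - c * p x) has_sum (mean p f - c * 1)) UNIV"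
    unfolding mean_def by (intro has_sum_diff has_sum_cmult_right p_sum has_sum_infsum)
  then show ?thesis
    unfolding mean_def by (simp add: left_diff_distrib infsumI)
qed

lemma fun_action_diff_const:
  assumes "f \<in> l2 q"
  shows "fun_action M (\<lambda>x. f x - c) = (\<lambda>x. fun_action M f x - c)"
proof
  fix x
  have "((\<lambda>y. M x y * f y - c * M x y) has_sum (fun_action M f x - c * 1)) UNIV"
    unfolding fun_action_def
    by (intro has_sum_diff has_sum_cmult_right markov_kernelD(3)[OF markov] has_sum_infsum
        row_summable assms)
  then show "fun_action M (\<lambda>x. f x - c) x = fun_action M f x - c"
    unfolding fun_action_def by (simp add: right_diff_distrib mult.commute infsumI)
qed

text \<open>Rows of mass 1 carry the constant through \<open>M\<close> unchanged, and centering
  removes it. This drives the semigroup law.\<close>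

lemma centered_diff_const:
  assumes "f \<in> l2 q"
  shows "centered (\<lambda>x. f x - c) = centered f"
  by (simp add: centered_def fun_action_diff_const mean_diff_const fun_action_l2 assms)

text \<open>The density of a point mass at \<open>z\<close> makes the pushed-forward measure the row
  \<open>M z\<close>.\<close>

lemma adj_point_density: "adj (\<lambda>x. (if x = z then 1 else 0) / p x) y = M z y / q y"
proof -
  have "p x * M x y * ((if x = z then 1 else 0) / p x) = (if x = z then 1 else 0) * M x y" for x
    using p_pos[of x] by simp
  then show ?thesis
    unfolding adj_def using infsumI[OF has_sum_delta_mult[of z "\<lambda>x. M x y"]] by simp
qed

lemma mean_point_density: "mean p (\<lambda>x. (if x = z then 1 else 0) / p x) = 1"
proof -
  have "(if x = z then 1 else 0) / p x * p x = (if x = z then 1 else 0) * 1" for x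
    using p_pos[of x] by simp
  then show ?thesis
    unfolding mean_def using infsumI[OF has_sum_delta_mult[of z "\<lambda>_. 1"]] by simp
qed

lemma point_density_l2: "(\<lambda>x. (if x = z then 1 else 0) / p x) \<in> l2 p"
proof -
  have "(\<lambda>x. (if x = z then 1 else 0) / p x) = (\<lambda>x. inverse (p z) * (if x = z then 1 else 0))"
    by (auto simp: field_simps)
  then show ?thesis using l2_cmult[OF l2_delta] by simp
qed

end

text \<open>Boundedness is used twice: \<open>|f|\<close> lies in \<open>l2 r\<close>, so its image
  under \<open>B\<close> lies in \<open>l2 q\<close>, and hence is summable against each row of
  \<open>A\<close>. These are the hypotheses of Fubini.\<close>

lemma dominated_kernel_fun_action_comp:
  assumes A: "dominated_kernel A p q C" and B: "dominated_kernel B q r D" and f: "f \<in> l2 r"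
  shows "fun_action (kernel_comp A B) f = fun_action A (fun_action B f)"
proof
  fix x
  interpret A: dominated_kernel A p q C by (rule A)
  interpret B: dominated_kernel B q r D by (rule B)
  show "fun_action (kernel_comp A B) f x = fun_action A (fun_action B f) x"
    by (rule fun_action_kernel_comp[OF A.nonneg(1) B.nonneg(1) B.row_summable[OF l2_abs[OF f]]
          A.row_summable[OF B.fun_action_l2[OF l2_abs[OF f]]]])
qed

text \<open>For positive \<open>s\<close> the recursion tests \<open>s \<le> s - 1\<close>, fails,
  and takes the identity branch.\<close>

lemma kernel_prod_self [simp]: "kernel_prod K s s = kernel_id"
  by (cases s) simp_all

section \<open>Domination in a non-decreasing environment\<close>

locale environment =
  fixes K :: "nat \<Rightarrow> 'v kernel" and \<pi> :: "nat \<Rightarrow> 'v \<Rightarrow> real"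
  assumes env: "finite_nondecreasing_environment K \<pi>"
    and zero: "\<pi> 0 = \<pi> 1"
begin

lemma K_markov: "markov_kernel (K (Suc t))"
  and K_invariant: "measure_action (\<pi> (Suc t)) (K (Suc t)) = \<pi> (Suc t)"
  using env unfolding finite_nondecreasing_environment_def by (metis le_add1 plus_1_eq_Suc)+

lemma pi_pos: "0 < \<pi> t x" and pi_summable: "\<pi> t summable_on UNIV"
proof -
  have "0 < \<pi> (Suc n) x \<and> \<pi> (Suc n) summable_on UNIV" for n
    using env unfolding finite_nondecreasing_environment_def by (metis le_add1 plus_1_eq_Suc)
  then show "0 < \<pi> t x" "\<pi> t summable_on UNIV"
    using zero by (cases t; simp)+
qed

lemma pi_mono: "\<pi> t x \<le> \<pi> (Suc t) x"
proof (cases t)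
  case 0
  with zero show ?thesis by simp
next
  case (Suc n)
  then show ?thesis
    using env unfolding finite_nondecreasing_environment_def by (metis Suc_eq_plus1 le_add2)
qed

lemma markov_kernel_prod: "markov_kernel (kernel_prod K s t)"
  by (induction t) (auto intro: markov_kernel_id markov_kernel_comp K_markov)

lemma kernel_prod_split:
  assumes "s \<le> r" "r \<le> t"
  shows "kernel_prod K s t = kernel_comp (kernel_prod K s r) (kernel_prod K r t)"
  using assms(2)
proof (induction t rule: dec_induct)
  case base
  then show ?case by (simp add: kernel_comp_id_right)
next
  case (step t)
  then show ?case
    using assms(1) by (simp add: kernel_comp_assoc markov_kernel_prod K_markov)
qed

text \<open>Both sides start at the point mass and multiply on the right by the next kernel, so they
  agree step by step.\<close>

lemma law_eq: "law K z t = kernel_prod K 0 t z"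
proof (induction t)
  case 0
  show ?case by (auto simp: kernel_id_def)
next
  case (Suc t)
  then show ?case by (auto simp: measure_action_def kernel_comp_def)
qed

lemma markov_weighted_summable:
  assumes "markov_kernel M"
  shows "(\<lambda>x. \<pi> t x * M x y) summable_on UNIV"
  by (rule summable_on_abs_le[OF pi_summable[of t]])
    (use pi_pos[of t] markov_kernelD[OF assms] in \<open>simp add: mult_left_le less_imp_le\<close>)

text \<open>Induction on \<open>t\<close>: enlarge \<open>\<pi> s K_{s,t} \<le> \<pi> t\<close> to
  \<open>\<pi> (Suc t)\<close>, apply the positive kernel \<open>K (Suc t)\<close>, and use that
  \<open>\<pi> (Suc t)\<close> is invariant under it.\<close>

lemma measure_action_kernel_prod_le:
  assumes "s \<le> t"
  shows "measure_action (\<pi> s) (kernel_prod K s t) y \<le> \<pi> t y"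
  using assms
proof (induction t arbitrary: y rule: dec_induct)
  case base
  then show ?case by (simp add: measure_action_kernel_id)
next
  case (step t)
  let ?\<mu> = "measure_action (\<pi> s) (kernel_prod K s t)"
  have le: "?\<mu> x * K (Suc t) x y \<le> \<pi> (Suc t) x * K (Suc t) x y" for x
    by (intro mult_right_mono order_trans[OF step.IH pi_mono] markov_kernelD(1)[OF K_markov])
  have nn: "0 \<le> ?\<mu> x" for x
    unfolding measure_action_def
    by (rule infsum_nonneg)
      (simp add: markov_kernelD(1)[OF markov_kernel_prod] less_imp_le[OF pi_pos])
  have sum: "(\<lambda>x. \<pi> (Suc t) x * K (Suc t) x y) summable_on UNIV"
    by (rule markov_weighted_summable[OF K_markov])
  have sum': "(\<lambda>x. ?\<mu> x * K (Suc t) x y) summable_on UNIV"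
    by (rule summable_on_comparison_test[OF sum le]) (simp add: nn markov_kernelD(1)[OF K_markov])
  have "measure_action (\<pi> s) (kernel_prod K s (Suc t)) y = measure_action ?\<mu> (K (Suc t)) y"
    using step.hyps
    by (simp add: measure_action_kernel_comp pi_summable less_imp_le[OF pi_pos]
        markov_kernel_prod K_markov)
  also have "\<dots> \<le> measure_action (\<pi> (Suc t)) (K (Suc t)) y"
    unfolding measure_action_def[of _ "K (Suc t)"] by (rule infsum_mono[OF sum' sum le])
  finally show ?case by (simp add: K_invariant)
qed

lemma pi_total_pos: "0 < (\<Sum>\<^sub>\<infinity>x. \<pi> t x)"
proof -
  \<comment> \<open>Here \<open>undefined\<close> is any point of the nonempty type; its positive
    weight bounds the total from below.\<close>
  have "sum (\<pi> t) {undefined} \<le> (\<Sum>\<^sub>\<infinity>x. \<pi> t x)"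
    by (rule finite_sum_le_infsum) (simp_all add: pi_summable less_imp_le[OF pi_pos])
  then show ?thesis using pi_pos[of t undefined] by simp
qed

lemma normalized_has_sum: "(normalized (\<pi> t) has_sum 1) UNIV"
proof -
  have "((\<lambda>x. inverse (\<Sum>\<^sub>\<infinity>y. \<pi> t y) * \<pi> t x) has_sum
      inverse (\<Sum>\<^sub>\<infinity>y. \<pi> t y) * (\<Sum>\<^sub>\<infinity>y. \<pi> t y)) UNIV"
    by (intro has_sum_cmult_right has_sum_infsum pi_summable)
  moreover have "normalized (\<pi> t) = (\<lambda>x. inverse (\<Sum>\<^sub>\<infinity>y. \<pi> t y) * \<pi> t x)"
    by (simp add: normalized_def fun_eq_iff divide_inverse mult.commute)
  ultimately show ?thesis
    using pi_total_pos[of t] by simp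
qed

text \<open>Normalizing \<open>\<pi> s K_{s,t} \<le> \<pi> t\<close> divides by the mass at time
  \<open>s\<close> and restores the mass at time \<open>t\<close>; their ratio is the
  constant.\<close>

lemma kernel_prod_dominated:
  assumes "s \<le> t"
  shows "dominated_kernel (kernel_prod K s t) (normalized (\<pi> s)) (normalized (\<pi> t))
    ((\<Sum>\<^sub>\<infinity>x. \<pi> t x) / (\<Sum>\<^sub>\<infinity>x. \<pi> s x))"
proof
  show "markov_kernel (kernel_prod K s t)" by (rule markov_kernel_prod)
  show "0 < normalized (\<pi> s) x" "0 < normalized (\<pi> t) x" for x
    by (simp_all add: normalized_def pi_pos pi_total_pos)
  show "(normalized (\<pi> s) has_sum 1) UNIV" by (rule normalized_has_sum)
  fix y
  have "measure_action (normalized (\<pi> s)) (kernel_prod K s t) y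
      = inverse (\<Sum>\<^sub>\<infinity>x. \<pi> s x) * measure_action (\<pi> s) (kernel_prod K s t) y"
    by (simp add: measure_action_def normalized_def divide_inverse ac_simps
        flip: infsum_cmult_right')
  also have "\<dots> \<le> inverse (\<Sum>\<^sub>\<infinity>x. \<pi> s x) * \<pi> t y"
    using pi_total_pos[of s] measure_action_kernel_prod_le[OF assms]
    by (intro mult_left_mono) (simp_all add: less_imp_le)
  also have "\<dots> = (\<Sum>\<^sub>\<infinity>x. \<pi> t x) / (\<Sum>\<^sub>\<infinity>x. \<pi> s x) * normalized (\<pi> t) y"
    using pi_total_pos[of t] by (simp add: normalized_def divide_inverse)
  finally show "measure_action (normalized (\<pi> s)) (kernel_prod K s t) y
      \<le> (\<Sum>\<^sub>\<infinity>x. \<pi> t x) / (\<Sum>\<^sub>\<infinity>x. \<pi> s x) * normalized (\<pi> t) y" .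
qed

section \<open>The operators of the environment and the proposition\<close>

lemma O_op_eq_centered:
  assumes "s \<le> t"
  shows "O_op K \<pi> s t = dominated_kernel.centered (kernel_prod K s t) (normalized (\<pi> s))"
  by (simp add: fun_eq_iff O_op_def K_op_def
      dominated_kernel.centered_def[OF kernel_prod_dominated[OF assms]])

lemma O_op_semigroup:
  assumes sr: "s \<le> r" and rt: "r \<le> t" and f: "f \<in> l2 (normalized (\<pi> t))"
  shows "O_op K \<pi> s r (O_op K \<pi> r t f) = O_op K \<pi> s t f"
proof -
  note doms = kernel_prod_dominated[OF sr] kernel_prod_dominated[OF rt]
  have K_comp: "K_op K s t f = K_op K s r (K_op K r t f)"
    unfolding K_op_def kernel_prod_split[OF sr rt]
    by (rule dominated_kernel_fun_action_comp[OF doms f])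
  have "K_op K r t f \<in> l2 (normalized (\<pi> r))"
    unfolding K_op_def by (rule dominated_kernel.fun_action_l2[OF doms(2) f])
  \<comment> \<open>The inner operator differs from \<open>K_op K r t f\<close> by a constant, which
    the outer centering ignores.\<close>
  then have "O_op K \<pi> s r (O_op K \<pi> r t f) = O_op K \<pi> s r (K_op K r t f)"
    unfolding O_op_eq_centered[OF sr] O_op_def
    by (rule dominated_kernel.centered_diff_const[OF doms(1)])
  also have "\<dots> = O_op K \<pi> s t f"
    by (simp add: O_op_def K_comp)
  finally show ?thesis .
qed

end

theorem proposition3p8:
  fixes K :: "nat \<Rightarrow> ('v::countable) kernel"
    and \<pi> :: "nat \<Rightarrow> 'v \<Rightarrow> real"
  assumes env: "finite_nondecreasing_environment K \<pi>"
    and irreducible: "\<And>t. t \<ge> 1 \<Longrightarrow> irreducible_kernel (K t)"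
    and aperiodic: "\<And>t. t \<ge> 1 \<Longrightarrow> aperiodic_kernel (K t)"
    and zero: "\<pi> 0 = \<pi> 1"
  shows
    \<comment> \<open>the operators and their duals are well defined\<close>
    "(\<forall>s t. s \<le> t \<longrightarrow>
        K_op K s t \<in> l2 (normalized (\<pi> t)) \<rightarrow> l2 (normalized (\<pi> s)) \<and>
        O_op K \<pi> s t \<in> l2 (normalized (\<pi> t)) \<rightarrow> l2 (normalized (\<pi> s)) \<and>
        is_dual (normalized (\<pi> t)) (normalized (\<pi> s)) (K_op K s t) (K_dual K \<pi> s t) \<and>
        is_dual (normalized (\<pi> t)) (normalized (\<pi> s)) (O_op K \<pi> s t) (O_dual K \<pi> s t))
     \<and> (\<forall>t\<ge>1. \<forall>s r. s \<le> r \<and> r \<le> t \<longrightarrow>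
          (\<forall>f\<in>l2 (normalized (\<pi> t)). O_op K \<pi> s r (O_op K \<pi> r t f) = O_op K \<pi> s t f))
     \<and> (\<forall>s t. s \<le> t \<longrightarrow>
          (\<forall>f\<in>l2 (normalized (\<pi> s)).
             O_dual K \<pi> s t f =
               (\<lambda>x. K_dual K \<pi> s t f x
                     - mean (normalized (\<pi> s)) f * K_dual K \<pi> s t (\<lambda>_. 1) x)))
     \<and> (\<forall>z. \<forall>t\<ge>1.
          O_dual K \<pi> 0 t (law_density K \<pi> z 0) =
            (\<lambda>x. law_density K \<pi> z t x - K_dual K \<pi> 0 t (\<lambda>_. 1) x))"
proof -
  interpret environment K \<pi>
    using env zero by unfold_locales
  have well_defined:
    "K_op K s t \<in> l2 (normalized (\<pi> t)) \<rightarrow> l2 (normalized (\<pi> s)) \<and>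
     O_op K \<pi> s t \<in> l2 (normalized (\<pi> t)) \<rightarrow> l2 (normalized (\<pi> s)) \<and>
     is_dual (normalized (\<pi> t)) (normalized (\<pi> s)) (K_op K s t) (K_dual K \<pi> s t) \<and>
     is_dual (normalized (\<pi> t)) (normalized (\<pi> s)) (O_op K \<pi> s t) (O_dual K \<pi> s t)"
    if "s \<le> t" for s t
  proof -
    interpret M: dominated_kernel "kernel_prod K s t" "normalized (\<pi> s)" "normalized (\<pi> t)"
      "(\<Sum>\<^sub>\<infinity>x. \<pi> t x) / (\<Sum>\<^sub>\<infinity>x. \<pi> s x)"
      by (rule kernel_prod_dominated[OF that])
    show ?thesis
      unfolding K_dual_def O_dual_def K_op_def O_op_eq_centered[OF that]
      using M.fun_action_l2 M.centered_l2 M.is_dual_fun_action M.is_dual_centered by blast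
  qed
  have O_dual_eq: "O_dual K \<pi> s t f =
      (\<lambda>x. K_dual K \<pi> s t f x - mean (normalized (\<pi> s)) f * K_dual K \<pi> s t (\<lambda>_. 1) x)"
    if "s \<le> t" "f \<in> l2 (normalized (\<pi> s))" for s t f
  proof -
    interpret M: dominated_kernel "kernel_prod K s t" "normalized (\<pi> s)" "normalized (\<pi> t)"
      "(\<Sum>\<^sub>\<infinity>x. \<pi> t x) / (\<Sum>\<^sub>\<infinity>x. \<pi> s x)"
      by (rule kernel_prod_dominated[OF that(1)])
    show ?thesis
      unfolding K_dual_def O_dual_def K_op_def O_op_eq_centered[OF that(1)]
      using that(2) l2_const[OF M.p_summable]
      by (simp add: M.dual_centered M.dual_fun_action M.centered_adj_def)
  qed
  have density: "O_dual K \<pi> 0 t (law_density K \<pi> z 0) =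
      (\<lambda>x. law_density K \<pi> z t x - K_dual K \<pi> 0 t (\<lambda>_. 1) x)" for z t
  proof -
    interpret M: dominated_kernel "kernel_prod K 0 t" "normalized (\<pi> 0)" "normalized (\<pi> t)"
      "(\<Sum>\<^sub>\<infinity>x. \<pi> t x) / (\<Sum>\<^sub>\<infinity>x. \<pi> 0 x)"
      by (rule kernel_prod_dominated) simp
    have h0: "law_density K \<pi> z 0 = (\<lambda>x. (if x = z then 1 else 0) / normalized (\<pi> 0) x)"
      by (simp add: law_density_def fun_eq_iff)
    \<comment> \<open>The adjoint yields row \<open>z\<close> of \<open>K_{0,t}\<close> over the
      normalized \<open>\<pi> t\<close>, and that row is the law at time \<open>t\<close>.\<close>
    have "K_dual K \<pi> 0 t (law_density K \<pi> z 0) = law_density K \<pi> z t"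
      unfolding K_dual_def K_op_def h0 M.dual_fun_action[OF M.point_density_l2]
      by (rule ext) (simp only: M.adj_point_density law_density_def law_eq)
    then show ?thesis
      \<comment> \<open>The initial density has mean 1, so the coefficient of the dual applied to
        the constant 1 is 1.\<close>
      using O_dual_eq[OF le0, of "law_density K \<pi> z 0" t] M.point_density_l2 M.mean_point_density
      by (simp only: h0 mult_1)
  qed
  show ?thesis
    by (intro conjI; intro allI impI ballI)
      (erule well_defined, erule conjE, erule (2) O_op_semigroup, erule (1) O_dual_eq, rule density)
qed

end
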